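(* Fix $0<\alpha<\frac12$. Assume that for some $\epsilon_0,\delta_0>0$, $\min_{i\in[n]}\min_{x\in\Omega_i}\mathbb P_x[\tau_{i,\mathrm{esc}}>\epsilon_0\varphi_{\max}]\ge\delta_0$, and assume also that $$\max_{i\in[n]}\ \max_{x\in\Omega_i}\ \mathbb P_x\big[\tau_{i,\mathrm{esc}}>\epsilon\,\varphi_{\max}\big]\le1-\delta$$ for some $\epsilon,\delta>0$. For $c>0$, let $G_c$ be the directed graph with vertex set $[n]$ and edge set $$E_c=\Big\{(i,j):\ \min_{x\in\Omega_i}\mathbb P_x\big[X_{\tau_{i,\mathrm{esc}}}\in\Omega_j\big]\ge c\Big\},$$ and let $D$ be the (directed) diameter of $G_c$ (if $D=\infty$ the bound below is trivial). Then $$\overline\varphi_{\mathrm{hit}}\le\epsilon\,\varphi_{\max}\,D\,(c\,\delta)^{-D}.$$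
   Context: $[n]=\{1,\dots,n\}$. $\{X_t\}_{t\in\mathbb N}$ is an irreducible, reversible, $\frac12$-lazy (i.e. $K(x,x)\ge\frac12$ for all $x$) Markov chain with kernel $K$ and stationary distribution $\pi$ on a finite state space $\Omega$. $\mathbb P_x,\mathbb E_x$ refer to the chain started at $X_0=x$. The mixing time of a Markov chain is the smallest $t>0$ such that $\max_x\|\mathcal L(X_t\mid X_0=x)-\pi\|_{\mathrm{TV}}<\frac14$. $\Omega=\bigsqcup_{i=1}^n\Omega_i$ is a partition into $n$ nonempty parts. The trace of the chain on $\Omega_i$ is the Markov chain on $\Omega_i$ with kernel $K_i(x,y)=\mathbb P_x[X_{\sigma}=y]$, $\sigma=\min\{t\ge1:X_t\in\Omega_i\}$. $\varphi_i$ is the mixing time of $K_i$ and $\varphi_{\max}=\max_{1\le i\le n}\varphi_i$. For $X_0\in\Omega_i$, the escape time is $\tau_{i,\mathrm{esc}}=\min\{t>0:X_t\notin\Omega_i\}$. For $A\subset\Omega$, $\tau_A=\min\{t\ge0:X_t\in A\}$, and $$\overline\varphi_{\mathrm{hit}}=\max_{I\subset[n]:\ \pi(\cup_{i\in I}\Omega_i)\ge\frac\alpha2}\ \max_{x\in\Omega}\ \mathbb E_x\big[\tau_{\cup_{i\in I}\Omega_i}\big].$$ *)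

theory Defs
  imports "HOL-Probability.Probability"
begin

section \<open>Finite Markov chains\<close>

text \<open>
  A chain on the finite state space \<^typ>\<open>'a\<close> is given by its kernel \<open>K :: 'a \<Rightarrow> 'a pmf\<close>, so that
  \<open>K(x,y) = pmf (K x) y\<close>. A chain on a subset \<open>S\<close> of the type is a kernel with
  \<open>set_pmf (K x) \<subseteq> S\<close> for \<open>x \<in> S\<close>; the values of \<open>K\<close> outside \<open>S\<close> are irrelevant.
\<close>

definition law_at :: "('a \<Rightarrow> 'a pmf) \<Rightarrow> nat \<Rightarrow> 'a \<Rightarrow> 'a pmf" where
  "law_at K t x = ((\<lambda>\<mu>. bind_pmf \<mu> K) ^^ t) (return_pmf x)"

definition irreducible_kernel :: "('a \<Rightarrow> 'a pmf) \<Rightarrow> bool" where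
  "irreducible_kernel K \<longleftrightarrow> (\<forall>x y. \<exists>t. pmf (law_at K t x) y > 0)"

definition half_lazy :: "('a \<Rightarrow> 'a pmf) \<Rightarrow> bool" where
  "half_lazy K \<longleftrightarrow> (\<forall>x. pmf (K x) x \<ge> 1 / 2)"

definition reversible_wrt :: "('a \<Rightarrow> 'a pmf) \<Rightarrow> 'a pmf \<Rightarrow> bool" where
  "reversible_wrt K \<pi> \<longleftrightarrow> (\<forall>x y. pmf \<pi> x * pmf (K x) y = pmf \<pi> y * pmf (K y) x)"

definition is_stationary :: "'a set \<Rightarrow> ('a \<Rightarrow> 'a pmf) \<Rightarrow> 'a pmf \<Rightarrow> bool" where
  "is_stationary S K \<mu> \<longleftrightarrow> set_pmf \<mu> \<subseteq> S \<and> bind_pmf \<mu> K = \<mu>"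

definition tv_dist :: "'a pmf \<Rightarrow> 'a pmf \<Rightarrow> real" where
  "tv_dist \<mu> \<nu> = (SUP A. \<bar>measure_pmf.prob \<mu> A - measure_pmf.prob \<nu> A\<bar>)"

definition mixing_time :: "'a set \<Rightarrow> ('a \<Rightarrow> 'a pmf) \<Rightarrow> nat" where
  "mixing_time S K =
     (LEAST t. t > 0 \<and> (MAX x\<in>S. tv_dist (law_at K t x) (THE \<mu>. is_stationary S K \<mu>)) < 1 / 4)"


section \<open>The path measure\<close>

definition step_kernel :: "('a \<Rightarrow> 'a pmf) \<Rightarrow> 'a \<Rightarrow> nat \<Rightarrow> (nat \<Rightarrow> 'a) \<Rightarrow> 'a measure" where
  "step_kernel K x t \<omega> = measure_pmf (case t of 0 \<Rightarrow> return_pmf x | Suc s \<Rightarrow> K (\<omega> s))"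

text \<open>
  \<open>path_measure K x\<close> is the law \<open>\<P>\<^sub>x\<close> on trajectories \<open>\<omega> :: nat \<Rightarrow> 'a\<close> of the chain started at \<open>x\<close>,
  with \<open>X\<^sub>t(\<omega>) = \<omega> t\<close>, obtained from the Ionescu-Tulcea theorem. Its finite-dimensional
  distributions are computed in \<open>path_measure_cylinder\<close> below.
\<close>

definition path_measure :: "('a \<Rightarrow> 'a pmf) \<Rightarrow> 'a \<Rightarrow> (nat \<Rightarrow> 'a) measure" where
  "path_measure K x =
     projective_family.lim UNIV (Ionescu_Tulcea.CI (step_kernel K x) (\<lambda>_. count_space UNIV))
       (\<lambda>_. count_space UNIV)"

lemma Ionescu_Tulcea_step_kernel:
  "Ionescu_Tulcea (step_kernel K (x::'a::finite)) (\<lambda>_. count_space UNIV)"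
proof (rule Ionescu_Tulcea.intro)
  fix i :: nat
  have "PiM {0..<i} (\<lambda>_. count_space (UNIV :: 'a set)) = count_space (PiE {0..<i} (\<lambda>_. UNIV))"
    by (rule count_space_PiM_finite) auto
  then show "step_kernel K x i \<in> PiM {0..<i} (\<lambda>_. count_space UNIV) \<rightarrow>\<^sub>M subprob_algebra (count_space UNIV)"
    by (auto simp: step_kernel_def measure_pmf_in_subprob_algebra)
next
  fix i \<omega>
  show "prob_space (step_kernel K x i \<omega>)"
    unfolding step_kernel_def by (rule measure_pmf.prob_space_axioms)
qed

lemma sets_path_measure [measurable_cong]:
  "sets (path_measure K (x::'a::finite)) = sets (PiM UNIV (\<lambda>_. count_space UNIV))"
proof -
  interpret Ionescu_Tulcea "step_kernel K x" "\<lambda>_. count_space UNIV"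
    by (rule Ionescu_Tulcea_step_kernel)
  show ?thesis unfolding path_measure_def by simp
qed

lemma space_path_measure [simp]: "space (path_measure K (x::'a::finite)) = UNIV"
  using sets_eq_imp_space_eq[OF sets_path_measure[of K x]] by (simp add: space_PiM)

lemma prob_space_path_measure: "prob_space (path_measure K (x::'a::finite))"
proof -
  interpret Ionescu_Tulcea "step_kernel K x" "\<lambda>_. count_space UNIV"
    by (rule Ionescu_Tulcea_step_kernel)
  interpret CI: prob_space "CI {}" 
    using PF.prob_space_P by auto
  have "emeasure (path_measure K x) (prod_emb UNIV (\<lambda>_. count_space UNIV) {} (space (PiM {} (\<lambda>_. count_space UNIV))))
     = emeasure (CI {}) (space (PiM {} (\<lambda>_. count_space UNIV)))"
    unfolding path_measure_def by (rule lim) auto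
  also have "\<dots> = 1"
    using CI.emeasure_space_1 by (simp add: PF.space_P CI_def)
  finally have "emeasure (path_measure K x) UNIV = 1"
    by (simp add: prod_emb_def space_PiM restrict_def vimage_def)
  then show ?thesis by (intro prob_spaceI) simp
qed

lemma path_measure_cylinder:
  fixes x :: "'a::finite"
  shows "measure (path_measure K x) {\<omega>. \<forall>k\<le>n. \<omega> k = p k} =
    (if p 0 = x then \<Prod>k<n. pmf (K (p k)) (p (Suc k)) else 0)"
proof -
  let ?M = "\<lambda>_::nat. count_space (UNIV::'a set)"
  interpret Ionescu_Tulcea "step_kernel K x" ?M
    by (rule Ionescu_Tulcea_step_kernel)
  have PiM_eq: "PiM {0..<m} ?M = count_space (PiE {0..<m} (\<lambda>_. UNIV))" for m
    by (rule count_space_PiM_finite) auto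
  define q where "q m = restrict p {0..<m}" for m
  have q_space: "q m \<in> PiE {0..<m} (\<lambda>_. UNIV)" for m
    by (auto simp: q_def)
  let ?u = "\<lambda>_::nat. undefined :: 'a"
  have u_space: "?u \<in> space (PiM {0..<0} ?M)"
    by (simp add: space_PiM)
  have C_Suc: "emeasure (C 0 (Suc m) ?u) {q (Suc m)} =
      emeasure (C 0 m ?u) {q m} * emeasure (step_kernel K x m (q m)) {p m}" for m
  proof -
    have eP: "emeasure (eP m \<omega>) {q (Suc m)} = indicator {q m} \<omega> * emeasure (step_kernel K x m (q m)) {p m}"
      if "\<omega> \<in> space (PiM {0..<m} ?M)" for \<omega>
    proof -
      have ext: "\<omega> \<in> extensional {0..<m}"
        using that by (auto simp: space_PiM PiE_def)
      have upd: "fun_upd \<omega> m y = q (Suc m) \<longleftrightarrow> \<omega> = q m \<and> y = p m" for y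
      proof
        assume eq: "fun_upd \<omega> m y = q (Suc m)"
        have "\<omega> k = q m k" for k
          using fun_cong[OF eq, of k] ext by (cases "k < m"; cases "k = m") (auto simp: q_def extensional_def)
        then show "\<omega> = q m \<and> y = p m"
          using fun_cong[OF eq, of m] by (auto simp: q_def)
      qed (auto simp: q_def fun_eq_iff)
      have "emeasure (eP m \<omega>) {q (Suc m)} =
          emeasure (step_kernel K x m \<omega>) ((\<lambda>y. fun_upd \<omega> m y) -` {q (Suc m)} \<inter> space (count_space UNIV))"
        by (rule emeasure_eP[OF that]) (use q_space[of "Suc m"] in \<open>simp add: PiM_eq\<close>)
      also have "(\<lambda>y. fun_upd \<omega> m y) -` {q (Suc m)} = (if \<omega> = q m then {p m} else {})"
        by (rule set_eqI) (simp only: vimage_eq singleton_iff upd, auto)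
      finally show ?thesis by (simp split: split_indicator)
    qed
    have "emeasure (C 0 (Suc m) ?u) {q (Suc m)} = (\<integral>\<^sup>+\<omega>. emeasure (eP m \<omega>) {q (Suc m)} \<partial>C 0 m ?u)"
      unfolding C.simps add_0
    proof (rule emeasure_bind)
      show "space (C 0 m ?u) \<noteq> {}"
        using prob_space.not_empty[OF prob_space_C[OF u_space]] .
      have "sets (C 0 m ?u) = sets (PiM {0..<m} ?M)"
        using sets_C[OF u_space] by simp
      then show "eP m \<in> C 0 m ?u \<rightarrow>\<^sub>M subprob_algebra (PiM {0..<Suc m} ?M)"
        using measurable_eP[of m] measurable_cong_sets by blast
      show "{q (Suc m)} \<in> sets (PiM {0..<Suc m} ?M)"
        using q_space[of "Suc m"] by (simp add: PiM_eq)
    qed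
    also have "\<dots> = (\<integral>\<^sup>+\<omega>. emeasure (step_kernel K x m (q m)) {p m} * indicator {q m} \<omega> \<partial>C 0 m ?u)"
      by (rule nn_integral_cong) (use space_C[OF u_space] in \<open>simp add: eP mult.commute\<close>)
    also have "\<dots> = emeasure (step_kernel K x m (q m)) {p m} * emeasure (C 0 m ?u) {q m}"
    proof (rule nn_integral_cmult_indicator)
      show "{q m} \<in> sets (C 0 m ?u)"
        using sets_C[OF u_space, of m] q_space[of m] by (simp add: PiM_eq)
    qed
    finally show ?thesis by (simp add: mult.commute)
  qed
  have C: "emeasure (C 0 (Suc m) ?u) {q (Suc m)} =
      ennreal (if p 0 = x then \<Prod>k<m. pmf (K (p k)) (p (Suc k)) else 0)" for m
  proof (induction m)
    case 0
    have "emeasure (C 0 0 ?u) {q 0} = 1"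
      by (simp add: q_def PiM_empty restrict_def)
    then show ?case
      unfolding C_Suc[of 0] by (auto simp: step_kernel_def emeasure_pmf_single indicator_def)
  next
    case (Suc m)
    have "emeasure (step_kernel K x (Suc m) (q (Suc m))) {p (Suc m)} = ennreal (pmf (K (p m)) (p (Suc m)))"
      by (simp add: step_kernel_def emeasure_pmf_single q_def)
    then show ?case
      unfolding C_Suc[of "Suc m"] Suc.IH by (simp add: ennreal_mult prod_nonneg)
  qed
  have "{q (Suc n)} \<in> sets (PiM {0..<Suc n} ?M)"
    using q_space[of "Suc n"] by (simp add: PiM_eq)
  then have "emeasure (path_measure K x) (prod_emb UNIV ?M {0..<Suc n} {q (Suc n)}) = emeasure (CI {0..<Suc n}) {q (Suc n)}"
    unfolding path_measure_def by (intro lim) auto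
  also have "\<dots> = emeasure (C 0 (Suc n) ?u) (prod_emb {0..<Suc n} ?M {0..<Suc n} {q (Suc n)})"
    by (rule emeasure_CI) (use q_space[of "Suc n"] in \<open>auto simp: PiM_eq\<close>)
  also have "prod_emb {0..<Suc n} ?M {0..<Suc n} {q (Suc n)} = {q (Suc n)}"
    using q_space[of "Suc n"] by (intro prod_emb_id) auto
  also have "prod_emb UNIV ?M {0..<Suc n} {q (Suc n)} = {\<omega>. \<forall>k\<le>n. \<omega> k = p k}"
    by (auto simp: prod_emb_def q_def restrict_def fun_eq_iff less_Suc_eq_le) metis
  finally show ?thesis
    unfolding C measure_def by (auto simp: prod_nonneg)
qed


lemma path_measure_sets [measurable (raw)]:
  "{\<omega>. Q \<omega>} \<in> sets (path_measure K (x::'a::finite))"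
  if "Measurable.pred (PiM UNIV (\<lambda>_. count_space UNIV)) Q"
  using that by (simp add: pred_def sets_path_measure space_PiM)

lemma pred_coord [measurable]:
  "Measurable.pred (PiM UNIV (\<lambda>_::nat. count_space (UNIV :: 'a::finite set))) (\<lambda>\<omega>. Q (\<omega> t))"
  by (rule measurable_compose[OF measurable_component_singleton[of t]]) auto


section \<open>Hitting, return and escape times\<close>

definition hitting_time :: "'a set \<Rightarrow> (nat \<Rightarrow> 'a) \<Rightarrow> enat" where
  "hitting_time A \<omega> = (INF t\<in>{t. \<omega> t \<in> A}. enat t)"

definition return_time :: "'a set \<Rightarrow> (nat \<Rightarrow> 'a) \<Rightarrow> enat" where
  "return_time A \<omega> = (INF t\<in>{t. t \<ge> 1 \<and> \<omega> t \<in> A}. enat t)"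

definition escape_time :: "'a set \<Rightarrow> (nat \<Rightarrow> 'a) \<Rightarrow> enat" where
  "escape_time S \<omega> = (INF t\<in>{t. t > 0 \<and> \<omega> t \<notin> S}. enat t)"

text \<open>
  \<open>stopped_in \<sigma> A\<close> is the event that \<open>X\<^sub>\<sigma> \<in> A\<close>, which includes \<open>\<sigma> < \<infinity>\<close>.
\<close>

definition stopped_in :: "((nat \<Rightarrow> 'a) \<Rightarrow> enat) \<Rightarrow> 'a set \<Rightarrow> (nat \<Rightarrow> 'a) set" where
  "stopped_in \<sigma> A = {\<omega>. \<exists>t. \<sigma> \<omega> = enat t \<and> \<omega> t \<in> A}"

definition expected_hitting_time :: "('a \<Rightarrow> 'a pmf) \<Rightarrow> 'a \<Rightarrow> 'a set \<Rightarrow> ennreal" where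
  "expected_hitting_time K x A = (\<integral>\<^sup>+\<omega>. ennreal_of_enat (hitting_time A \<omega>) \<partial>path_measure K x)"

text \<open>
  The trace kernel on \<open>S\<close>: \<open>K\<^sub>S(x,y) = \<P>\<^sub>x[X\<^sub>\<sigma> = y]\<close> with \<open>\<sigma>\<close> the return time to \<open>S\<close>. The right-hand side
  is a probability mass function whenever \<open>\<sigma>\<close> is almost surely finite; see \<open>pmf_trace_kernel\<close> below.
\<close>

definition trace_kernel :: "('a \<Rightarrow> 'a pmf) \<Rightarrow> 'a set \<Rightarrow> 'a \<Rightarrow> 'a pmf" where
  "trace_kernel K S x =
     embed_pmf (\<lambda>y. measure (path_measure K x) (stopped_in (return_time S) {y}))"

lemma return_time_eq_enat_iff:
  "return_time A \<omega> = enat t \<longleftrightarrow> t \<ge> 1 \<and> \<omega> t \<in> A \<and> (\<forall>s\<in>{1..<t}. \<omega> s \<notin> A)"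
proof (cases "\<exists>t. t \<ge> 1 \<and> \<omega> t \<in> A")
  case True
  define m where "m = (LEAST t. t \<ge> 1 \<and> \<omega> t \<in> A)"
  have m: "m \<ge> 1 \<and> \<omega> m \<in> A"
    unfolding m_def using True by (rule LeastI_ex)
  have m_le: "m \<le> t" if "t \<ge> 1" "\<omega> t \<in> A" for t
    unfolding m_def using that by (intro Least_le) auto
  have "return_time A \<omega> = enat m"
    unfolding return_time_def using m m_le by (intro antisym INF_greatest INF_lower) auto
  moreover have "t = m" if "t \<ge> 1 \<and> \<omega> t \<in> A \<and> (\<forall>s\<in>{1..<t}. \<omega> s \<notin> A)"
    using that m m_le[of t] by (cases "m < t") auto
  moreover have "\<forall>s\<in>{1..<m}. \<omega> s \<notin> A"
    using m_le by force
  ultimately show ?thesis using m by (metis enat.inject)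
next
  case False
  then have "{t. t \<ge> 1 \<and> \<omega> t \<in> A} = {}" by blast
  then have "return_time A \<omega> = \<infinity>"
    unfolding return_time_def by (simp only: image_empty Inf_empty top_enat_def)
  with False show ?thesis by auto
qed

lemma path_measure_start:
  "measure (path_measure K (x::'a::finite)) {\<omega>. \<omega> 0 = y} = (if y = x then 1 else 0)"
  using path_measure_cylinder[of K x 0 "\<lambda>_. y"] by simp

lemma path_measure_markov:
  fixes x :: "'a::finite"
  assumes Q: "\<And>\<omega> \<omega>'. (\<forall>k\<le>m. \<omega> k = \<omega>' k) \<Longrightarrow> Q \<omega> \<longleftrightarrow> Q \<omega>'"
  shows "measure (path_measure K x) {\<omega>. Q \<omega> \<and> \<omega> m = y \<and> \<omega> (Suc m) = z} =
    measure (path_measure K x) {\<omega>. Q \<omega> \<and> \<omega> m = y} * pmf (K y) z"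
proof -
  interpret prob_space "path_measure K x" by (rule prob_space_path_measure)
  let ?I = "{p \<in> PiE {..m} (\<lambda>_. UNIV :: 'a set). Q p \<and> p m = y}"
  have fin: "finite ?I"
    by (intro finite_subset[OF _ finite_PiE[of "{..m}" "\<lambda>_. UNIV :: 'a set"]]) auto
  have eq: "{\<omega>. Q \<omega> \<and> \<omega> m = y \<and> R \<omega>} = (\<Union>p\<in>?I. {\<omega>. (\<forall>k\<le>m. \<omega> k = p k) \<and> R \<omega>})" for R
  proof (intro set_eqI iffI)
    fix \<omega> assume \<omega>: "\<omega> \<in> {\<omega>. Q \<omega> \<and> \<omega> m = y \<and> R \<omega>}"
    have "Q (restrict \<omega> {..m})"
      using \<omega> Q[of \<omega> "restrict \<omega> {..m}"] by auto
    with \<omega> show "\<omega> \<in> (\<Union>p\<in>?I. {\<omega>. (\<forall>k\<le>m. \<omega> k = p k) \<and> R \<omega>})"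
      by (intro UN_I[of "restrict \<omega> {..m}"]) auto
  next
    fix \<omega> assume "\<omega> \<in> (\<Union>p\<in>?I. {\<omega>. (\<forall>k\<le>m. \<omega> k = p k) \<and> R \<omega>})"
    then obtain p where p: "Q p" "p m = y" "\<forall>k\<le>m. \<omega> k = p k" "R \<omega>"
      by auto
    have "Q \<omega>" using Q[OF p(3)] p(1) by simp
    with p show "\<omega> \<in> {\<omega>. Q \<omega> \<and> \<omega> m = y \<and> R \<omega>}" by auto
  qed
  have disj: "disjoint_family_on (\<lambda>p. {\<omega>. (\<forall>k\<le>m. \<omega> k = p k) \<and> R \<omega>}) ?I" for R
    unfolding disjoint_family_on_def
  proof (intro ballI impI)
    fix p p' assume pp: "p \<in> ?I" "p' \<in> ?I" "p \<noteq> p'"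
    then have "\<exists>k\<le>m. p k \<noteq> p' k"
      by (metis (mono_tags, lifting) PiE_ext atMost_iff mem_Collect_eq)
    then show "{\<omega>. (\<forall>k\<le>m. \<omega> k = p k) \<and> R \<omega>} \<inter> {\<omega>. (\<forall>k\<le>m. \<omega> k = p' k) \<and> R \<omega>} = {}"
      by auto
  qed
  have sets: "{\<omega>. (\<forall>k\<le>m. \<omega> k = p k) \<and> \<omega> (Suc m) = z} \<in> events"
    "{\<omega>. (\<forall>k\<le>m. \<omega> k = p k)} \<in> events" for p
    by measurable
  have cyl: "measure (path_measure K x) {\<omega>. (\<forall>k\<le>m. \<omega> k = p k) \<and> \<omega> (Suc m) = z} =
     measure (path_measure K x) {\<omega>. (\<forall>k\<le>m. \<omega> k = p k)} * pmf (K y) z" if p: "p m = y" for p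
  proof -
    have "{\<omega>. (\<forall>k\<le>m. \<omega> k = p k) \<and> \<omega> (Suc m) = z} = {\<omega>. \<forall>k\<le>Suc m. \<omega> k = (fun_upd p (Suc m) z) k}"
      by (auto simp: le_Suc_eq)
    then show ?thesis
      by (simp only: path_measure_cylinder) (simp add: p)
  qed
  have "measure (path_measure K x) {\<omega>. Q \<omega> \<and> \<omega> m = y \<and> \<omega> (Suc m) = z} =
      (\<Sum>p\<in>?I. measure (path_measure K x) {\<omega>. (\<forall>k\<le>m. \<omega> k = p k) \<and> \<omega> (Suc m) = z})"
    unfolding eq using sets by (intro finite_measure_finite_Union fin disj) auto
  also have "\<dots> = (\<Sum>p\<in>?I. measure (path_measure K x) {\<omega>. \<forall>k\<le>m. \<omega> k = p k}) * pmf (K y) z"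
    unfolding sum_distrib_right by (intro sum.cong refl cyl) auto
  also have "(\<Sum>p\<in>?I. measure (path_measure K x) {\<omega>. \<forall>k\<le>m. \<omega> k = p k}) =
      measure (path_measure K x) {\<omega>. Q \<omega> \<and> \<omega> m = y}"
  proof -
    have "measure (path_measure K x) {\<omega>. Q \<omega> \<and> \<omega> m = y \<and> True} =
        (\<Sum>p\<in>?I. measure (path_measure K x) {\<omega>. (\<forall>k\<le>m. \<omega> k = p k) \<and> True})"
      unfolding eq using sets by (intro finite_measure_finite_Union fin disj) auto
    then show ?thesis by (simp only: simp_thms)
  qed
  finally show ?thesis .
qed

primrec avoid_prob :: "('a::finite \<Rightarrow> 'a pmf) \<Rightarrow> 'a set \<Rightarrow> nat \<Rightarrow> 'a \<Rightarrow> real" where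
  "avoid_prob K S 0 x = 1"
| "avoid_prob K S (Suc k) x = (\<Sum>y\<in>-S. pmf (K x) y * avoid_prob K S k y)"

lemma path_measure_avoid:
  fixes x :: "'a::finite"
  shows "measure (path_measure K x) {\<omega>. \<forall>k\<in>{1..m}. \<omega> k \<notin> S} = avoid_prob K S m x"
proof -
  interpret prob_space "path_measure K x" by (rule prob_space_path_measure)
  define g where "g m y = measure (path_measure K x) {\<omega>. (\<forall>k\<in>{1..m}. \<omega> k \<notin> S) \<and> \<omega> m = y}" for m y
  have g_Suc: "g (Suc m) z = (if z \<in> S then 0 else \<Sum>y\<in>UNIV. g m y * pmf (K y) z)" for m z
  proof (cases "z \<in> S")
    case True
    then have empty: "{\<omega>. (\<forall>k\<in>{1..Suc m}. \<omega> k \<notin> S) \<and> \<omega> (Suc m) = z} = {}" by force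
    with True show ?thesis unfolding g_def empty by simp
  next
    case False
    have "{\<omega>. (\<forall>k\<in>{1..Suc m}. \<omega> k \<notin> S) \<and> \<omega> (Suc m) = z} =
       (\<Union>y\<in>UNIV. {\<omega>. (\<forall>k\<in>{1..m}. \<omega> k \<notin> S) \<and> \<omega> m = y \<and> \<omega> (Suc m) = z})"
      using False by (auto simp: le_Suc_eq)
    then have "g (Suc m) z = (\<Sum>y\<in>UNIV. measure (path_measure K x)
        {\<omega>. (\<forall>k\<in>{1..m}. \<omega> k \<notin> S) \<and> \<omega> m = y \<and> \<omega> (Suc m) = z})"
      unfolding g_def
      by (simp only:) (intro finite_measure_finite_Union, auto simp: disjoint_family_on_def)
    also have "\<dots> = (\<Sum>y\<in>UNIV. g m y * pmf (K y) z)"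
      unfolding g_def by (intro sum.cong refl path_measure_markov) auto
    finally show ?thesis using False by simp
  qed
  have g_add: "(\<Sum>y\<in>UNIV. g (m + k) y) = (\<Sum>z\<in>UNIV. g m z * avoid_prob K S k z)" for m k
  proof (induction k arbitrary: m)
    case (Suc k)
    have "(\<Sum>y\<in>UNIV. g (m + Suc k) y) = (\<Sum>w\<in>UNIV. g (Suc m) w * avoid_prob K S k w)"
      using Suc.IH[of "Suc m"] by simp
    also have "\<dots> = (\<Sum>w\<in>-S. \<Sum>z\<in>UNIV. g m z * (pmf (K z) w * avoid_prob K S k w))"
      unfolding g_Suc by (rule sum.mono_neutral_cong_right) (auto simp: sum_distrib_right mult.assoc)
    also have "\<dots> = (\<Sum>z\<in>UNIV. g m z * avoid_prob K S (Suc k) z)"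
      by (subst sum.swap) (simp add: sum_distrib_left)
    finally show ?case .
  qed simp
  have "{\<omega>. \<forall>k\<in>{1..m}. \<omega> k \<notin> S} = (\<Union>y\<in>UNIV. {\<omega>. (\<forall>k\<in>{1..m}. \<omega> k \<notin> S) \<and> \<omega> m = y})"
    by auto
  then have "measure (path_measure K x) {\<omega>. \<forall>k\<in>{1..m}. \<omega> k \<notin> S} = (\<Sum>y\<in>UNIV. g m y)"
    unfolding g_def by (simp only:) (intro finite_measure_finite_Union, auto simp: disjoint_family_on_def)
  also have "\<dots> = (\<Sum>z\<in>UNIV. g 0 z * avoid_prob K S m z)"
    using g_add[of 0 m] by simp
  also have "\<dots> = (\<Sum>z\<in>UNIV. if z = x then avoid_prob K S m z else 0)"
    unfolding g_def by (intro sum.cong refl) (simp add: path_measure_start)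
  finally show ?thesis by simp
qed

lemma avoid_prob_tendsto_0:
  fixes x :: "'a::finite"
  assumes irr: "irreducible_kernel K" and "S \<noteq> {}" and "e > 0"
  shows "\<exists>m. avoid_prob K S m x < e"
proof -
  let ?h = "avoid_prob K S"
  have nonneg: "?h k z \<ge> 0" for k z
    by (induction k arbitrary: z) (auto intro!: sum_nonneg)
  have sum_K: "(\<Sum>y\<in>UNIV. pmf (K z) y) = 1" for z
    by (simp add: sum_pmf_eq_1)
  have le1: "?h 1 z \<le> 1" for z
  proof -
    have "?h 1 z \<le> (\<Sum>y\<in>UNIV. pmf (K z) y)"
      by (simp, rule sum_mono2) auto
    then show ?thesis by (simp add: sum_K)
  qed
  have Suc_le: "?h (Suc k) z \<le> ?h k z" for k z
  proof (induction k arbitrary: z)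
    case 0 then show ?case using le1[of z] by simp
  next
    case (Suc k)
    show ?case
      unfolding avoid_prob.simps(2)[of K S "Suc k" z] avoid_prob.simps(2)[of K S k z]
      by (intro sum_mono mult_left_mono Suc.IH) auto
  qed
  have anti: "?h k z \<le> ?h j z" if "j \<le> k" for j k z
    using that Suc_le by (rule lift_Suc_antimono_le[of "\<lambda>k. ?h k z", rotated])
  have le_1: "?h k z \<le> 1" for k z
    using anti[of 0 k z] by simp
  define U where "U = {z. \<forall>t. ?h t z = 1}"
  have U_step: "w \<in> U \<and> w \<notin> S" if z: "z \<in> U" and w: "w \<in> set_pmf (K z)" for z w
  proof (rule ccontr)
    assume "\<not> (w \<in> U \<and> w \<notin> S)"
    then obtain t where t: "w \<in> S \<or> ?h t w < 1"
      using le_1 unfolding U_def by (force simp: less_le)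
    have "1 = (\<Sum>y\<in>UNIV. pmf (K z) y * (if y \<in> S then 0 else ?h t y))"
    proof -
      have "1 = ?h (Suc t) z" using z by (simp add: U_def del: avoid_prob.simps)
      also have "\<dots> = (\<Sum>y\<in>UNIV. pmf (K z) y * (if y \<in> S then 0 else ?h t y))"
        unfolding avoid_prob.simps by (rule sum.mono_neutral_cong_left) auto
      finally show ?thesis .
    qed
    also have "\<dots> < (\<Sum>y\<in>UNIV. pmf (K z) y * 1)"
    proof (rule sum_strict_mono_ex1)
      show "\<forall>y\<in>UNIV. pmf (K z) y * (if y \<in> S then 0 else ?h t y) \<le> pmf (K z) y * 1"
        using le_1 by (auto intro: mult_left_le)
      show "\<exists>y\<in>UNIV. pmf (K z) y * (if y \<in> S then 0 else ?h t y) < pmf (K z) y * 1"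
        using t pmf_positive[OF w] by (intro bexI[of _ w]) (auto simp: mult_less_cancel_left2)
    qed simp
    finally show False by (simp add: sum_K)
  qed
  have "U = {}"
  proof (rule ccontr)
    assume "U \<noteq> {}"
    then obtain z where z: "z \<in> U" by auto
    obtain w where w: "w \<in> set_pmf (K z)" using set_pmf_not_empty[of "K z"] by blast
    have reach: "set_pmf (law_at K t w) \<subseteq> U - S" for t
    proof (induction t)
      case 0 then show ?case using U_step[OF z w] by (simp add: law_at_def)
    next
      case (Suc t)
      have "law_at K (Suc t) w = bind_pmf (law_at K t w) K" by (simp add: law_at_def)
      then show ?case using Suc.IH U_step by auto
    qed
    obtain s where "s \<in> S" using \<open>S \<noteq> {}\<close> by auto
    obtain t where "pmf (law_at K t w) s > 0" using irr unfolding irreducible_kernel_def by blast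
    then have "s \<in> set_pmf (law_at K t w)" by (simp add: set_pmf_iff)
    with reach[of t] \<open>s \<in> S\<close> show False by auto
  qed
  then have "\<forall>z. \<exists>t. ?h t z < 1"
    using le_1 unfolding U_def by (force simp: less_le)
  then obtain T where T: "?h (T z) z < 1" for z by metis
  define N where "N = Max (range T)"
  have N: "?h N z < 1" for z
    using anti[of "T z" N z] T[of z] by (simp add: N_def)
  define r where "r = Max (range (?h N))"
  have r1: "r < 1" using N by (simp add: r_def)
  have hr: "?h N z \<le> r" for z by (simp add: r_def)
  have r0: "r \<ge> 0" using nonneg hr order_trans by blast
  have h_add: "?h (k + N) z \<le> r * ?h k z" for k z
  proof (induction k arbitrary: z)
    case (Suc k)
    have "?h (Suc k + N) z \<le> (\<Sum>y\<in>-S. pmf (K z) y * (r * ?h k y))"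
      by (simp, intro sum_mono mult_left_mono Suc.IH) auto
    then show ?case by (simp add: sum_distrib_left mult.left_commute)
  qed (simp add: hr)
  have pow: "?h (j * N) z \<le> r ^ j" for j z
  proof (induction j)
    case (Suc j)
    have "?h (Suc j * N) z \<le> r * ?h (j * N) z" using h_add[of "j * N" z] by (simp add: add.commute)
    also have "\<dots> \<le> r * r ^ j" using Suc.IH r0 by (intro mult_left_mono) auto
    finally show ?case by simp
  qed simp
  obtain j where "r ^ j < e" using real_arch_pow_inv[OF \<open>e > 0\<close> r1] by blast
  with pow[of j x] show ?thesis by (intro exI[of _ "j * N"]) linarith
qed

lemma pmf_trace_kernel:
  fixes x :: "'a::finite"
  assumes irr: "irreducible_kernel K" and S: "S \<noteq> {}"
  shows "pmf (trace_kernel K S x) y = measure (path_measure K x) (stopped_in (return_time S) {y})"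
  unfolding trace_kernel_def
proof (rule pmf_embed_pmf)
  interpret prob_space "path_measure K x" by (rule prob_space_path_measure)
  have sets: "stopped_in (return_time S) A \<in> events" for A
    unfolding stopped_in_def return_time_eq_enat_iff by measurable
  have "prob (space (path_measure K x) - stopped_in (return_time S) UNIV) \<le> 0"
  proof (rule field_le_epsilon)
    fix e :: real assume "e > 0"
    obtain m where m: "avoid_prob K S m x < e"
      using avoid_prob_tendsto_0[OF irr S \<open>e > 0\<close>] by blast
    have "prob (space (path_measure K x) - stopped_in (return_time S) UNIV) \<le>
        prob {\<omega>. \<forall>k\<in>{1..m}. \<omega> k \<notin> S}"
    proof (rule finite_measure_mono)
      show "space (path_measure K x) - stopped_in (return_time S) UNIV \<subseteq> {\<omega>. \<forall>k\<in>{1..m}. \<omega> k \<notin> S}"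
      proof
        fix \<omega> assume "\<omega> \<in> space (path_measure K x) - stopped_in (return_time S) UNIV"
        then have "return_time S \<omega> = \<infinity>"
          by (cases "return_time S \<omega>") (auto simp: stopped_in_def)
        moreover have "return_time S \<omega> \<le> enat k" if "k \<ge> 1" "\<omega> k \<in> S" for k
          unfolding return_time_def using that by (intro INF_lower) auto
        ultimately show "\<omega> \<in> {\<omega>. \<forall>k\<in>{1..m}. \<omega> k \<notin> S}" by force
      qed
    qed measurable
    also have "\<dots> < e" using m by (simp only: path_measure_avoid)
    finally show "prob (space (path_measure K x) - stopped_in (return_time S) UNIV) \<le> 0 + e" by simp
  qed
  then have "prob (stopped_in (return_time S) UNIV) = 1"
    using prob_compl[OF sets[of UNIV]] prob_le_1[of "stopped_in (return_time S) UNIV"] by linarith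
  also have "stopped_in (return_time S) UNIV = (\<Union>y\<in>UNIV. stopped_in (return_time S) {y})"
    by (auto simp: stopped_in_def)
  also have "prob \<dots> = (\<Sum>y\<in>UNIV. prob (stopped_in (return_time S) {y}))"
    by (intro finite_measure_finite_Union image_subsetI sets)
      (auto simp: disjoint_family_on_def stopped_in_def)
  finally show "(\<integral>\<^sup>+y. ennreal (prob (stopped_in (return_time S) {y})) \<partial>count_space UNIV) = 1"
    by (simp add: nn_integral_count_space_finite)
qed simp


section \<open>Directed diameter\<close>

text \<open>
  The graph distance from \<open>i\<close> to \<open>j\<close> is the least length of a directed walk along \<open>E\<close>, and
  \<open>\<infinity>\<close> if there is none.
\<close>

definition digraph_dist :: "('v \<times> 'v) set \<Rightarrow> 'v \<Rightarrow> 'v \<Rightarrow> enat" where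
  "digraph_dist E i j = (INF k\<in>{k. (i, j) \<in> E ^^ k}. enat k)"

definition digraph_diameter :: "'v set \<Rightarrow> ('v \<times> 'v) set \<Rightarrow> enat" where
  "digraph_diameter V E = (SUP i\<in>V. SUP j\<in>V. digraph_dist E i j)"


section \<open>Partitioned state space\<close>

definition phi_max :: "('a \<Rightarrow> 'a pmf) \<Rightarrow> nat \<Rightarrow> (nat \<Rightarrow> 'a set) \<Rightarrow> nat" where
  "phi_max K n \<Omega> = (MAX i\<in>{1..n}. mixing_time (\<Omega> i) (trace_kernel K (\<Omega> i)))"

definition phi_hit ::
    "('a::finite \<Rightarrow> 'a pmf) \<Rightarrow> 'a pmf \<Rightarrow> nat \<Rightarrow> (nat \<Rightarrow> 'a set) \<Rightarrow> real \<Rightarrow> ennreal" where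
  "phi_hit K \<pi> n \<Omega> \<alpha> =
     (MAX I\<in>{I. I \<subseteq> {1..n} \<and> measure_pmf.prob \<pi> (\<Union>i\<in>I. \<Omega> i) \<ge> \<alpha> / 2}.
        MAX x\<in>UNIV. expected_hitting_time K x (\<Union>i\<in>I. \<Omega> i))"

definition escape_tail :: "('a \<Rightarrow> 'a pmf) \<Rightarrow> 'a set \<Rightarrow> real \<Rightarrow> 'a \<Rightarrow> real" where
  "escape_tail K S s x =
     measure (path_measure K x) {\<omega>. ereal_of_enat (escape_time S \<omega>) > ereal s}"

definition escape_edges ::
    "('a \<Rightarrow> 'a pmf) \<Rightarrow> nat \<Rightarrow> (nat \<Rightarrow> 'a set) \<Rightarrow> real \<Rightarrow> (nat \<times> nat) set" where
  "escape_edges K n \<Omega> c =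
     {(i, j). i \<in> {1..n} \<and> j \<in> {1..n} \<and>
        (MIN x\<in>\<Omega> i. measure (path_measure K x) (stopped_in (escape_time (\<Omega> i)) (\<Omega> j))) \<ge> c}"

end

theory Submission
  imports Defs
begin

text \<open>
  Let \<open>A\<close> be the target, a union of parts, and let \<open>u = \<E>\<^sub>x[min \<tau>\<^sub>A T]\<close> for a fixed horizon \<open>T\<close>, which is
  finite and satisfies \<open>u \<le> 1 + K u\<close> off \<open>A\<close>, and put \<open>L = max u\<close>. The expected escape time of a part is
  at most \<open>r = \<epsilon> \<phi>\<^sub>m\<^sub>a\<^sub>x / \<delta>\<close>. If \<open>(i, j)\<close> is an edge and \<open>u \<le> l\<close> on \<open>\<Omega>\<^sub>j\<close>, optional stopping at the escape
  from \<open>\<Omega>\<^sub>i\<close> gives \<open>u \<le> r + c l + (1 - c) L\<close> on \<open>\<Omega>\<^sub>i\<close>. Iterating along a walk of length \<open>k\<close> ending in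
  the target yields \<open>u \<le> L - c\<^sup>k L + r k\<close>, which at a maximum point of \<open>u\<close> means
  \<open>L \<le> r k c\<^sup>-\<^sup>k\<close>. Escape time and escape position are thus used separately: no joint bound on them
  is needed.
\<close>

section \<open>Finite-horizon events and the first-step identity\<close>

text \<open>An event decided by coordinates up to \<open>m\<close> is a finite disjoint union of
  cylinders, one for each extensional \<open>p\<close> on \<open>{..m}\<close>. The map
  \<open>f\<close> lets this cover both a path and its shift.\<close>

lemma measure_finite_horizon:
  fixes f :: "'b \<Rightarrow> nat \<Rightarrow> 'a::finite"
  assumes M: "finite_measure M"
    and Q: "\<And>\<omega> \<omega>'. (\<forall>k\<le>m. \<omega> k = \<omega>' k) \<Longrightarrow> Q \<omega> \<longleftrightarrow> Q \<omega>'"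
    and sets: "\<And>p. {\<omega>. \<forall>k\<le>m. f \<omega> k = p k} \<in> sets M"
  shows "measure M {\<omega>. Q (f \<omega>)} =
    (\<Sum>p\<in>{p \<in> PiE {..m} (\<lambda>_. UNIV). Q p}. measure M {\<omega>. \<forall>k\<le>m. f \<omega> k = p k})"
proof -
  let ?I = "{p \<in> PiE {..m} (\<lambda>_. UNIV :: 'a set). Q p}"
  have fin: "finite ?I"
    by (intro finite_subset[OF _ finite_PiE[of "{..m}" "\<lambda>_. UNIV :: 'a set"]]) auto
  have "{\<omega>. Q (f \<omega>)} = (\<Union>p\<in>?I. {\<omega>. \<forall>k\<le>m. f \<omega> k = p k})"
  proof (intro set_eqI iffI)
    fix \<omega> assume "\<omega> \<in> {\<omega>. Q (f \<omega>)}"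
    then have "Q (restrict (f \<omega>) {..m})"
      using Q[of "f \<omega>" "restrict (f \<omega>) {..m}"] by auto
    then show "\<omega> \<in> (\<Union>p\<in>?I. {\<omega>. \<forall>k\<le>m. f \<omega> k = p k})"
      by (intro UN_I[of "restrict (f \<omega>) {..m}"]) auto
  qed (use Q in blast)
  moreover have "disjoint_family_on (\<lambda>p. {\<omega>. \<forall>k\<le>m. f \<omega> k = p k}) ?I"
    unfolding disjoint_family_on_def
  proof (intro ballI impI)
    fix p p' assume pp: "p \<in> ?I" "p' \<in> ?I" "p \<noteq> p'"
    then have "\<exists>k\<le>m. p k \<noteq> p' k"
      by (metis (mono_tags, lifting) PiE_ext atMost_iff mem_Collect_eq)
    then show "{\<omega>. \<forall>k\<le>m. f \<omega> k = p k} \<inter> {\<omega>. \<forall>k\<le>m. f \<omega> k = p' k} = {}"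
      by auto
  qed
  ultimately show ?thesis
    using sets by (simp only:) (intro finite_measure.finite_measure_finite_Union[OF M] fin, auto)
qed

text \<open>The Markov property at time 1. Both sides reduce to cylinders, where the product formula
  makes the claim explicit; the escape event, of infinite horizon, is reached later as an increasing
  limit.\<close>

lemma path_measure_first_step:
  fixes x :: "'a::finite"
  assumes Q: "\<And>\<omega> \<omega>'. (\<forall>k\<le>m. \<omega> k = \<omega>' k) \<Longrightarrow> Q \<omega> \<longleftrightarrow> Q \<omega>'"
  shows "measure (path_measure K x) {\<omega>. Q (\<lambda>k. \<omega> (Suc k))} =
    (\<Sum>y\<in>UNIV. pmf (K x) y * measure (path_measure K y) {\<omega>. Q \<omega>})"
proof -
  have fin: "finite_measure (path_measure K y)" for y
    using prob_space_path_measure by (rule prob_space.finite_measure)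
  have step: "measure (path_measure K x) {\<omega>. \<forall>k\<le>m. \<omega> (Suc k) = p k} =
      (\<Sum>y\<in>UNIV. pmf (K x) y * measure (path_measure K y) {\<omega>. \<forall>k\<le>m. \<omega> k = p k})" for p
  proof -
    \<comment> \<open>The event leaves \<open>\<omega> 0\<close> free, so \<open>z\<close> runs over
      its values to produce cylinders starting at time 0.\<close>
    have "{\<omega>. \<forall>k\<le>m. \<omega> (Suc k) = p k} = (\<Union>z\<in>UNIV. {\<omega>. \<forall>k\<le>Suc m. \<omega> k = case_nat z p k})"
    proof (intro set_eqI iffI)
      fix \<omega> assume "\<omega> \<in> {\<omega>. \<forall>k\<le>m. \<omega> (Suc k) = p k}"
      then show "\<omega> \<in> (\<Union>z\<in>UNIV. {\<omega>. \<forall>k\<le>Suc m. \<omega> k = case_nat z p k})"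
        by (intro UN_I[of "\<omega> 0"]) (auto split: nat.split)
    next
      fix \<omega> assume "\<omega> \<in> (\<Union>z\<in>UNIV. {\<omega>. \<forall>k\<le>Suc m. \<omega> k = case_nat z p k})"
      then obtain z where z: "\<forall>k\<le>Suc m. \<omega> k = case_nat z p k" by blast
      show "\<omega> \<in> {\<omega>. \<forall>k\<le>m. \<omega> (Suc k) = p k}"
      proof (intro CollectI allI impI)
        fix k assume "k \<le> m"
        then show "\<omega> (Suc k) = p k" using z[rule_format, of "Suc k"] by simp
      qed
    qed
    then have "measure (path_measure K x) {\<omega>. \<forall>k\<le>m. \<omega> (Suc k) = p k} =
        (\<Sum>z\<in>UNIV. measure (path_measure K x) {\<omega>. \<forall>k\<le>Suc m. \<omega> k = case_nat z p k})"
    proof (simp only:, intro finite_measure.finite_measure_finite_Union[OF fin] image_subsetI)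
      fix z show "{\<omega>. \<forall>k\<le>Suc m. \<omega> k = case_nat z p k} \<in> sets (path_measure K x)"
        by measurable
    next
      show "disjoint_family (\<lambda>z. {\<omega>. \<forall>k\<le>Suc m. \<omega> k = case_nat z p k})"
        unfolding disjoint_family_on_def by (auto dest!: spec[of _ 0])
    qed simp
    also have "\<dots> = (\<Sum>z\<in>UNIV. if z = x then pmf (K x) (p 0) * (\<Prod>k<m. pmf (K (p k)) (p (Suc k))) else 0)"
      by (intro sum.cong refl) (simp only: path_measure_cylinder prod.lessThan_Suc_shift, simp)
    \<comment> \<open>Each sum has at most one nonzero term: the start forces \<open>z = x\<close>,
      the cylinder seen from \<open>y\<close> forces \<open>y = p 0\<close>.\<close>
    also have "\<dots> = (\<Sum>y\<in>UNIV. if y = p 0 then pmf (K x) y * (\<Prod>k<m. pmf (K (p k)) (p (Suc k))) else 0)"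
      by simp
    also have "\<dots> = (\<Sum>y\<in>UNIV. pmf (K x) y * measure (path_measure K y) {\<omega>. \<forall>k\<le>m. \<omega> k = p k})"
      by (intro sum.cong refl) (auto simp: path_measure_cylinder)
    finally show ?thesis .
  qed
  have "measure (path_measure K x) {\<omega>. Q (\<lambda>k. \<omega> (Suc k))} =
      (\<Sum>p\<in>{p \<in> PiE {..m} (\<lambda>_. UNIV). Q p}.
        measure (path_measure K x) {\<omega>. \<forall>k\<le>m. \<omega> (Suc k) = p k})"
    by (rule measure_finite_horizon[OF fin Q]) measurable
  also have "\<dots> = (\<Sum>y\<in>UNIV. pmf (K x) y *
      (\<Sum>p\<in>{p \<in> PiE {..m} (\<lambda>_. UNIV). Q p}. measure (path_measure K y) {\<omega>. \<forall>k\<le>m. \<omega> k = p k}))"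
    unfolding step by (subst sum.swap) (simp add: sum_distrib_left)
  also have "\<dots> = (\<Sum>y\<in>UNIV. pmf (K x) y * measure (path_measure K y) {\<omega>. Q \<omega>})"
  proof (intro sum.cong refl arg_cong2[where f = "(*)"])
    fix y
    show "(\<Sum>p\<in>{p \<in> PiE {..m} (\<lambda>_. UNIV). Q p}. measure (path_measure K y) {\<omega>. \<forall>k\<le>m. \<omega> k = p k}) =
        measure (path_measure K y) {\<omega>. Q \<omega>}"
      by (rule measure_finite_horizon[OF fin Q, symmetric]) measurable
  qed
  finally show ?thesis .
qed

section \<open>Tails of return and hitting times\<close>

text \<open>Staying in \<open>S\<close> becomes avoiding \<open>- S\<close>, which makes the facts
  on return times and \<open>avoid_prob\<close> available for escapes.\<close>

lemma escape_time_eq_return_time: "escape_time S \<omega> = return_time (- S) \<omega>"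
  unfolding escape_time_def return_time_def by (auto intro!: arg_cong[where f = Inf])

lemma return_time_greater_iff: "enat t < return_time A \<omega> \<longleftrightarrow> (\<forall>k\<in>{1..t}. \<omega> k \<notin> A)"
proof
  assume t: "enat t < return_time A \<omega>"
  show "\<forall>k\<in>{1..t}. \<omega> k \<notin> A"
  proof (intro ballI notI)
    fix k assume "k \<in> {1..t}" "\<omega> k \<in> A"
    then have "return_time A \<omega> \<le> enat k" "k \<le> t"
      unfolding return_time_def by (auto intro: INF_lower)
    with t show False by (metis enat_ord_simps(1) leD order_trans)
  qed
next
  assume "\<forall>k\<in>{1..t}. \<omega> k \<notin> A"
  then have "enat (Suc t) \<le> return_time A \<omega>"
    unfolding return_time_def by (intro INF_greatest) (auto simp: not_less_eq_eq)
  then show "enat t < return_time A \<omega>" by (simp add: Suc_ile_eq)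
qed

lemma hitting_time_greater_iff: "enat t < hitting_time A \<omega> \<longleftrightarrow> (\<forall>k\<le>t. \<omega> k \<notin> A)"
proof
  assume t: "enat t < hitting_time A \<omega>"
  show "\<forall>k\<le>t. \<omega> k \<notin> A"
  proof (intro allI impI notI)
    fix k assume "k \<le> t" "\<omega> k \<in> A"
    then have "hitting_time A \<omega> \<le> enat k"
      unfolding hitting_time_def by (auto intro: INF_lower)
    with t \<open>k \<le> t\<close> show False by (metis enat_ord_simps(1) leD order_trans)
  qed
next
  assume "\<forall>k\<le>t. \<omega> k \<notin> A"
  then have "enat (Suc t) \<le> hitting_time A \<omega>"
    unfolding hitting_time_def by (intro INF_greatest) (auto simp: not_less_eq_eq)
  then show "enat t < hitting_time A \<omega>" by (simp add: Suc_ile_eq)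
qed

lemma avoid_prob_nonneg: "avoid_prob K A k x \<ge> 0"
  by (induction k arbitrary: x) (auto intro!: sum_nonneg)

lemma avoid_prob_le_1: "avoid_prob K A k x \<le> 1"
  unfolding path_measure_avoid[symmetric] by (rule prob_space.prob_le_1[OF prob_space_path_measure])

lemma AE_path_measure_start: "AE \<omega> in path_measure K (x::'a::finite). \<omega> 0 = x"
proof -
  interpret prob_space "path_measure K x" by (rule prob_space_path_measure)
  have "prob {\<omega>. \<omega> 0 = x} = 1"
    by (simp add: path_measure_start)
  moreover have "{\<omega>. \<omega> 0 = x} \<in> events" by measurable
  ultimately show ?thesis using AE_in_set_eq_1[of "{\<omega>. \<omega> 0 = x}"] by simp
qed

text \<open>Time 0 causes the case split: \<open>hitting_time\<close> counts it, whereas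
  \<open>avoid_prob\<close> looks at positive times. Paths start at \<open>x\<close> almost surely,
  so the events are compared up to null sets.\<close>

lemma measure_hitting_time_greater:
  "measure (path_measure K (x::'a::finite)) {\<omega>. enat t < hitting_time A \<omega>} =
    (if x \<in> A then 0 else avoid_prob K A t x)"
proof -
  interpret prob_space "path_measure K x" by (rule prob_space_path_measure)
  note AE0 = AE_path_measure_start[where K = K and x = x]
  show ?thesis
  proof (cases "x \<in> A")
    case True
    have "prob {\<omega>. enat t < hitting_time A \<omega>} = measure (path_measure K x) {}"
      unfolding hitting_time_greater_iff
    proof (rule finite_measure_eq_AE)
      show "AE \<omega> in path_measure K x. \<omega> \<in> {\<omega>. \<forall>k\<le>t. \<omega> k \<notin> A} \<longleftrightarrow> \<omega> \<in> {}"
        using AE0 by eventually_elim (use True in auto)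
    qed measurable
    then show ?thesis using True by simp
  next
    case False
    have "prob {\<omega>. enat t < hitting_time A \<omega>} = prob {\<omega>. \<forall>k\<in>{1..t}. \<omega> k \<notin> A}"
      unfolding hitting_time_greater_iff
    proof (rule finite_measure_eq_AE)
      show "AE \<omega> in path_measure K x. \<omega> \<in> {\<omega>. \<forall>k\<le>t. \<omega> k \<notin> A} \<longleftrightarrow> \<omega> \<in> {\<omega>. \<forall>k\<in>{1..t}. \<omega> k \<notin> A}"
        using AE0
      proof eventually_elim
        case (elim \<omega>)
        then have "(\<forall>k\<le>t. \<omega> k \<notin> A) \<longleftrightarrow> (\<forall>k\<in>{1..t}. \<omega> k \<notin> A)"
          using False by (metis atLeastAtMost_iff le0 not_one_le_zero One_nat_def Suc_leI gr0I)
        then show ?case by simp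
      qed
    qed measurable
    then show ?thesis using False by (simp only: path_measure_avoid if_False)
  qed
qed

section \<open>Truncated expected hitting times\<close>

text \<open>\<open>\<E>\<^sub>x[min \<tau>\<^sub>A T]\<close>, written as the tail sum \<open>\<Sum>t<T. \<P>\<^sub>x[\<tau>\<^sub>A > t]\<close>.\<close>

definition truncated_hit :: "('a::finite \<Rightarrow> 'a pmf) \<Rightarrow> 'a set \<Rightarrow> nat \<Rightarrow> 'a \<Rightarrow> real" where
  "truncated_hit K A T x = (\<Sum>t<T. if x \<in> A then 0 else avoid_prob K A t x)"

text \<open>The expectation is the series of tails, whose partial sums are the truncated
  expectations; a bound uniform in \<open>T\<close> therefore survives the limit.\<close>

lemma expected_hitting_time_le:
  fixes x :: "'a::finite"
  assumes "\<And>T. truncated_hit K A T x \<le> B"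
  shows "expected_hitting_time K x A \<le> ennreal B"
proof -
  interpret prob_space "path_measure K x" by (rule prob_space_path_measure)
  \<comment> \<open>The defining infimum runs over times depending on \<open>\<omega>\<close>. With
    default value \<infinity> it becomes a countable infimum of measurable functions.\<close>
  have "hitting_time A = (\<lambda>\<omega>. INF t\<in>UNIV. if \<omega> t \<in> A then enat t else \<infinity>)"
  proof (intro ext antisym)
    fix \<omega> :: "nat \<Rightarrow> 'a"
    show "hitting_time A \<omega> \<le> (INF t\<in>UNIV. if \<omega> t \<in> A then enat t else \<infinity>)"
      unfolding hitting_time_def by (rule INF_greatest) (simp add: INF_lower)
    show "(INF t\<in>UNIV. if \<omega> t \<in> A then enat t else \<infinity>) \<le> hitting_time A \<omega>"
      unfolding hitting_time_def
    proof (rule INF_greatest)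
      fix t assume "t \<in> {t. \<omega> t \<in> A}"
      then show "(INF t\<in>UNIV. if \<omega> t \<in> A then enat t else \<infinity>) \<le> enat t"
        by (intro INF_lower2[of t]) simp_all
    qed
  qed
  moreover have "(\<lambda>\<omega>. INF t\<in>UNIV. if \<omega> t \<in> A then enat t else \<infinity>)
      \<in> path_measure K x \<rightarrow>\<^sub>M count_space UNIV"
    by (rule measurable_INF) measurable
  ultimately have "hitting_time A \<in> path_measure K x \<rightarrow>\<^sub>M count_space UNIV"
    by (simp only:)
  then have "expected_hitting_time K x A = (\<Sum>t. emeasure (path_measure K x) {\<omega>. enat t < hitting_time A \<omega>})"
    unfolding expected_hitting_time_def by (simp add: nn_integral_enat_function)
  also have "\<dots> = (\<Sum>t. ennreal (if x \<in> A then 0 else avoid_prob K A t x))"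
    by (simp only: emeasure_eq_measure measure_hitting_time_greater)
  also have "\<dots> \<le> ennreal B"
  proof (rule suminf_le_const)
    fix T
    have "(\<Sum>t<T. ennreal (if x \<in> A then 0 else avoid_prob K A t x)) = ennreal (truncated_hit K A T x)"
      unfolding truncated_hit_def by (rule sum_ennreal) (auto simp: avoid_prob_nonneg)
    then show "(\<Sum>t<T. ennreal (if x \<in> A then 0 else avoid_prob K A t x)) \<le> ennreal B"
      using assms by (simp add: ennreal_leI)
  qed simp
  finally show ?thesis .
qed

lemma truncated_hit_nonneg: "truncated_hit K A T x \<ge> 0"
  unfolding truncated_hit_def by (intro sum_nonneg) (simp add: avoid_prob_nonneg)

lemma truncated_hit_in: "x \<in> A \<Longrightarrow> truncated_hit K A T x = 0"
  by (simp add: truncated_hit_def)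

text \<open>Off \<open>A\<close>, a first step gives equality with horizon \<open>Suc T\<close> on
  the left. Monotonicity in the horizon lowers it to \<open>T\<close>, leaving the same function on
  both sides.\<close>

lemma truncated_hit_superharmonic:
  fixes x :: "'a::finite"
  assumes "x \<notin> A"
  shows "truncated_hit K A T x \<le> 1 + (\<Sum>y\<in>UNIV. pmf (K x) y * truncated_hit K A T y)"
proof -
  have "truncated_hit K A T x \<le> truncated_hit K A (Suc T) x"
    by (simp add: truncated_hit_def avoid_prob_nonneg)
  also have "\<dots> = 1 + (\<Sum>t<T. \<Sum>y\<in>-A. pmf (K x) y * avoid_prob K A t y)"
    using assms by (simp add: truncated_hit_def sum.lessThan_Suc_shift del: sum.lessThan_Suc)
  also have "(\<Sum>t<T. \<Sum>y\<in>-A. pmf (K x) y * avoid_prob K A t y) =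
      (\<Sum>y\<in>-A. pmf (K x) y * (\<Sum>t<T. avoid_prob K A t y))"
    by (subst sum.swap) (simp add: sum_distrib_left)
  also have "\<dots> = (\<Sum>y\<in>UNIV. pmf (K x) y * truncated_hit K A T y)"
    by (rule sum.mono_neutral_cong_left) (auto simp: truncated_hit_def)
  finally show ?thesis .
qed

section \<open>Exit distributions and optional stopping\<close>

text \<open>For \<open>B\<close> disjoint from \<open>S\<close>, this is the probability that the
  escape from \<open>S\<close> happens by time \<open>T\<close> and lands in \<open>B\<close>. The
  index \<open>s\<close> starts at 1 because the escape time ignores the position at time 0.\<close>

definition exit_prob :: "('a::finite \<Rightarrow> 'a pmf) \<Rightarrow> 'a set \<Rightarrow> 'a set \<Rightarrow> nat \<Rightarrow> 'a \<Rightarrow> real" where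
  "exit_prob K S B T x =
     measure (path_measure K x) {\<omega>. \<exists>t\<in>{1..T}. \<omega> t \<in> B \<and> (\<forall>s\<in>{1..<t}. \<omega> s \<in> S)}"

lemma exit_prob_0: "exit_prob K S B 0 x = 0"
  by (simp add: exit_prob_def)

text \<open>After one step the chain is still in \<open>S\<close>, has exited into \<open>B\<close>,
  or has exited elsewhere and contributes 0.\<close>

lemma exit_prob_Suc:
  fixes x :: "'a::finite"
  assumes "B \<inter> S = {}"
  shows "exit_prob K S B (Suc T) x =
    (\<Sum>y\<in>UNIV. pmf (K x) y * (if y \<in> S then exit_prob K S B T y else if y \<in> B then 1 else 0))"
proof -
  define E where "E \<omega> \<longleftrightarrow> (\<exists>t\<in>{1..T}. \<omega> t \<in> B \<and> (\<forall>s\<in>{1..<t}. \<omega> s \<in> S))" for \<omega> :: "nat \<Rightarrow> 'a"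
  \<comment> \<open>\<open>Q\<close> is meant for the shifted path, whose coordinate 0 is the
    original time 1. Since \<open>E\<close> does not look at coordinate 0, \<open>Q\<close> tests it
    separately.\<close>
  define Q where "Q \<omega> \<longleftrightarrow> \<omega> 0 \<in> B \<or> \<omega> 0 \<in> S \<and> E \<omega>" for \<omega>
  have shift: "(\<exists>t\<in>{1..Suc T}. \<omega> t \<in> B \<and> (\<forall>s\<in>{1..<t}. \<omega> s \<in> S)) \<longleftrightarrow> Q (\<lambda>k. \<omega> (Suc k))" for \<omega>
  proof
    assume "\<exists>t\<in>{1..Suc T}. \<omega> t \<in> B \<and> (\<forall>s\<in>{1..<t}. \<omega> s \<in> S)"
    then obtain t where t: "t \<in> {1..Suc T}" "\<omega> t \<in> B" "\<forall>s\<in>{1..<t}. \<omega> s \<in> S" by blast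
    then obtain t' where t': "t = Suc t'" by (cases t) auto
    show "Q (\<lambda>k. \<omega> (Suc k))"
    proof (cases "t' = 0")
      case False
      then have "\<omega> (Suc 0) \<in> S" "E (\<lambda>k. \<omega> (Suc k))"
        using t t' by (auto simp: E_def intro!: bexI[of _ t'])
      then show ?thesis by (simp add: Q_def)
    qed (use t t' in \<open>simp add: Q_def\<close>)
  next
    assume "Q (\<lambda>k. \<omega> (Suc k))"
    then consider "\<omega> 1 \<in> B"
      | t where "\<omega> 1 \<in> S" "t \<in> {1..T}" "\<omega> (Suc t) \<in> B" "\<forall>s\<in>{1..<t}. \<omega> (Suc s) \<in> S"
      by (auto simp: Q_def E_def)
    then show "\<exists>t\<in>{1..Suc T}. \<omega> t \<in> B \<and> (\<forall>s\<in>{1..<t}. \<omega> s \<in> S)"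
    proof cases
      case 1
      then show ?thesis by (intro bexI[of _ 1]) auto
    next
      case (2 t)
      have "\<omega> s \<in> S" if "s \<in> {1..<Suc t}" for s
        using 2 that by (cases s; cases "s = 1") auto
      then show ?thesis using 2 by (intro bexI[of _ "Suc t"]) auto
    qed
  qed
  have "exit_prob K S B (Suc T) x = measure (path_measure K x) {\<omega>. Q (\<lambda>k. \<omega> (Suc k))}"
    by (simp only: exit_prob_def shift)
  also have "\<dots> = (\<Sum>y\<in>UNIV. pmf (K x) y * measure (path_measure K y) {\<omega>. Q \<omega>})"
  proof (rule path_measure_first_step)
    fix \<omega> \<omega>' :: "nat \<Rightarrow> 'a" assume eq: "\<forall>k\<le>T. \<omega> k = \<omega>' k"
    have "E \<omega> \<longleftrightarrow> E \<omega>'"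
      unfolding E_def using eq by (intro bex_cong refl conj_cong ball_cong) auto
    then show "Q \<omega> \<longleftrightarrow> Q \<omega>'" using eq by (simp add: Q_def)
  qed
  also have "\<dots> = (\<Sum>y\<in>UNIV. pmf (K x) y *
      (if y \<in> S then exit_prob K S B T y else if y \<in> B then 1 else 0))"
  proof (intro sum.cong refl arg_cong2[where f = "(*)"])
    fix y
    interpret prob_space "path_measure K y" by (rule prob_space_path_measure)
    let ?R = "\<lambda>\<omega>. if y \<in> S then E \<omega> else y \<in> B"
    \<comment> \<open>Once \<open>\<omega> 0\<close> is known to be \<open>y\<close>, disjointness
      of \<open>B\<close> and \<open>S\<close> lets at most one alternative of \<open>Q\<close>
      apply.\<close>
    have "AE \<omega> in path_measure K y. \<omega> 0 = y"
      by (rule AE_path_measure_start)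
    then have "AE \<omega> in path_measure K y. \<omega> \<in> {\<omega>. Q \<omega>} \<longleftrightarrow> \<omega> \<in> {\<omega>. ?R \<omega>}"
      by eventually_elim (use assms in \<open>auto simp: Q_def\<close>)
    then have "prob {\<omega>. Q \<omega>} = prob {\<omega>. ?R \<omega>}"
      unfolding Q_def E_def by (rule finite_measure_eq_AE) measurable
    then show "prob {\<omega>. Q \<omega>} = (if y \<in> S then exit_prob K S B T y else if y \<in> B then 1 else 0)"
      using prob_space by (auto simp: exit_prob_def E_def)
  qed
  finally show ?thesis .
qed

text \<open>The events increase in \<open>T\<close>. As \<open>B\<close> misses \<open>S\<close>, a
  visit to \<open>B\<close> preceded by positive times in \<open>S\<close> alone occurs exactly at
  the escape time.\<close>

lemma exit_prob_tendsto:
  fixes x :: "'a::finite"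
  assumes "B \<inter> S = {}"
  shows "(\<lambda>T. exit_prob K S B T x) \<longlonglongrightarrow> measure (path_measure K x) (stopped_in (escape_time S) B)"
proof -
  interpret prob_space "path_measure K x" by (rule prob_space_path_measure)
  let ?E = "\<lambda>T. {\<omega>. \<exists>t\<in>{1..T}. \<omega> t \<in> B \<and> (\<forall>s\<in>{1..<t}. \<omega> s \<in> S)}"
  have "stopped_in (escape_time S) B = (\<Union>T. ?E T)"
    using assms by (fastforce simp: stopped_in_def escape_time_eq_return_time return_time_eq_enat_iff)
  moreover have "(\<lambda>T. prob (?E T)) \<longlonglongrightarrow> prob (\<Union>T. ?E T)"
  proof (rule finite_Lim_measure_incseq)
    have "?E T \<in> events" for T by measurable
    then show "range ?E \<subseteq> events" by blast
    show "incseq ?E" by (fastforce simp: incseq_def)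
  qed
  ultimately show ?thesis by (simp add: exit_prob_def)
qed

text \<open>Stopping at the smaller of the escape time and \<open>T\<close>: the tail sum is the
  expected number of steps, and the stopped value is at most \<open>l\<close> after an exit into
  \<open>B\<close> and at most \<open>L\<close> otherwise.\<close>

lemma optional_stopping_at_exit:
  fixes u :: "'a::finite \<Rightarrow> real"
  assumes BS: "B \<inter> S = {}"
    and super: "\<And>x. x \<in> S \<Longrightarrow> u x \<le> 1 + (\<Sum>y\<in>UNIV. pmf (K x) y * u y)"
    and l: "\<And>y. y \<in> B \<Longrightarrow> u y \<le> l" and L: "\<And>y. u y \<le> L"
    and "x \<in> S"
  shows "u x \<le> (\<Sum>k<T. avoid_prob K (-S) k x) + L - (L - l) * exit_prob K S B T x"
  using \<open>x \<in> S\<close>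
proof (induction T arbitrary: x)
  case 0
  then show ?case using L by (simp add: exit_prob_0)
next
  case (Suc T)
  \<comment> \<open>\<open>?V\<close> and \<open>?q\<close> extend the remaining time and the exit
    probability to points outside \<open>S\<close>, where the process has already stopped.\<close>
  let ?V = "\<lambda>y. if y \<in> S then \<Sum>k<T. avoid_prob K (-S) k y else 0"
  let ?q = "\<lambda>y. if y \<in> S then exit_prob K S B T y else if y \<in> B then 1 else 0"
  have "u x \<le> 1 + (\<Sum>y\<in>UNIV. pmf (K x) y * u y)"
    using super Suc.prems .
  also have "\<dots> \<le> 1 + (\<Sum>y\<in>UNIV. pmf (K x) y * (?V y + L - (L - l) * ?q y))"
    by (intro add_left_mono sum_mono mult_left_mono) (use Suc.IH l L in auto)
  also have "\<dots> = 1 + (\<Sum>y\<in>UNIV. pmf (K x) y * ?V y) + L * (\<Sum>y\<in>UNIV. pmf (K x) y)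
      - (L - l) * (\<Sum>y\<in>UNIV. pmf (K x) y * ?q y)"
    by (simp add: sum_distrib_left sum.distrib[symmetric] sum_subtractf[symmetric] algebra_simps
        del: sum.distrib)
  also have "(\<Sum>y\<in>UNIV. pmf (K x) y) = 1"
    by (simp add: sum_pmf_eq_1)
  also have "(\<Sum>y\<in>UNIV. pmf (K x) y * ?q y) = exit_prob K S B (Suc T) x"
    by (simp only: exit_prob_Suc[OF BS])
  also have "(\<Sum>y\<in>UNIV. pmf (K x) y * ?V y) = (\<Sum>y\<in>S. pmf (K x) y * (\<Sum>k<T. avoid_prob K (-S) k y))"
    by (rule sum.mono_neutral_cong_right) auto
  also have "\<dots> = (\<Sum>k<T. avoid_prob K (-S) (Suc k) x)"
    by (simp add: sum_distrib_left) (rule sum.swap)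
  \<comment> \<open>The step just taken is the term \<open>k = 0\<close>, where
    \<open>avoid_prob\<close> equals 1.\<close>
  also have "1 + \<dots> = (\<Sum>k<Suc T. avoid_prob K (-S) k x)"
    by (subst sum.lessThan_Suc_shift) simp
  finally show ?case by simp
qed

section \<open>Expected escape time of a part\<close>

text \<open>Surviving \<open>m\<close> further steps costs a factor \<open>1 - \<delta>\<close> from
  any point of \<open>S\<close>, so shifting the tail sum by \<open>m\<close> contracts it. The sum
  is then bounded by \<open>m\<close> plus \<open>1 - \<delta>\<close> times itself.\<close>

lemma sum_avoid_prob_le:
  fixes x :: "'a::finite"
  assumes tail: "\<And>z. z \<in> S \<Longrightarrow> avoid_prob K (-S) m z \<le> 1 - \<delta>"
    and "\<delta> > 0" and "x \<in> S"
  shows "(\<Sum>k<T. avoid_prob K (-S) k x) \<le> real m / \<delta>"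
proof -
  let ?h = "avoid_prob K (-S)"
  \<comment> \<open>The induction peels off the first \<open>k\<close> steps, so the block of
    \<open>m\<close> steps comes last and starts inside \<open>S\<close>.\<close>
  have add: "?h (k + m) z \<le> (1 - \<delta>) * ?h k z" if "z \<in> S" for k z
    using that
  proof (induction k arbitrary: z)
    case (Suc k)
    have "?h (Suc k + m) z \<le> (\<Sum>y\<in>S. pmf (K z) y * ((1 - \<delta>) * ?h k y))"
      by (simp, intro sum_mono mult_left_mono Suc.IH) auto
    then show ?case by (simp add: sum_distrib_left mult.left_commute)
  qed (simp add: tail)
  have "(\<Sum>k<T. ?h k x) \<le> (\<Sum>k<T + m. ?h k x)"
    by (rule sum_mono2) (auto simp: avoid_prob_nonneg)
  also have "\<dots> = (\<Sum>k<m. ?h k x) + (\<Sum>k<T. ?h (k + m) x)"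
    by (induction T) (simp_all del: avoid_prob.simps)
  also have "\<dots> \<le> (\<Sum>k<m. 1) + (\<Sum>k<T. (1 - \<delta>) * ?h k x)"
    by (intro add_mono sum_mono avoid_prob_le_1 add \<open>x \<in> S\<close>)
  also have "\<dots> = real m + (1 - \<delta>) * (\<Sum>k<T. ?h k x)"
    by (simp add: sum_distrib_left)
  finally have "\<delta> * (\<Sum>k<T. ?h k x) \<le> real m"
    by (simp add: algebra_simps)
  then show ?thesis
    using \<open>\<delta> > 0\<close> by (simp add: field_simps)
qed

text \<open>An integer-valued time exceeds \<open>s\<close> exactly when it exceeds the floor of
  \<open>s\<close>.\<close>

lemma escape_tail_eq_avoid_prob:
  fixes x :: "'a::finite"
  assumes "s \<ge> 0"
  shows "escape_tail K S s x = avoid_prob K (-S) (nat \<lfloor>s\<rfloor>) x"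
proof -
  have "ereal_of_enat e > ereal s \<longleftrightarrow> e > enat (nat \<lfloor>s\<rfloor>)" for e
  proof (cases e)
    case (enat k)
    have "s < real k \<longleftrightarrow> nat \<lfloor>s\<rfloor> < k"
      using assms by linarith
    then show ?thesis by (simp add: enat)
  qed simp
  then show ?thesis
    unfolding escape_tail_def escape_time_eq_return_time return_time_greater_iff
    by (simp only: return_time_greater_iff path_measure_avoid)
qed

section \<open>Walks to the target and the final bound\<close>

text \<open>Without such a walk, every length in the defining infimum is at least
  \<open>Suc D\<close>; this includes the empty infimum, which is \<infinity>.\<close>

lemma walk_of_digraph_diameter:
  assumes "digraph_diameter V E = enat D" and "i \<in> V" and "j \<in> V"
  obtains k where "k \<le> D" and "(i, j) \<in> E ^^ k"
proof (rule ccontr)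
  assume "\<not> thesis"
  then have "enat (Suc D) \<le> digraph_dist E i j"
    unfolding digraph_dist_def using that by (intro INF_greatest) (force simp: not_less_eq_eq)
  also have "\<dots> \<le> enat D"
    unfolding assms(1)[symmetric] digraph_diameter_def
    using assms(2,3) by (meson SUP_upper SUP_upper2 order_refl)
  finally show False by simp
qed

theorem lemma2p6:
  fixes K :: "'a::finite \<Rightarrow> 'a pmf" and \<pi> :: "'a pmf"
    and n D :: nat and \<Omega> :: "nat \<Rightarrow> 'a set"
    and \<alpha> \<epsilon>\<^sub>0 \<delta>\<^sub>0 \<epsilon> \<delta> c :: real
  assumes "irreducible_kernel K" and "half_lazy K"
    and "is_stationary UNIV K \<pi>" and "reversible_wrt K \<pi>"
    and "disjoint_family_on \<Omega> {1..n}" and "(\<Union>i\<in>{1..n}. \<Omega> i) = UNIV"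
    and "\<forall>i\<in>{1..n}. \<Omega> i \<noteq> {}"
    and "0 < \<alpha>" and "\<alpha> < 1 / 2"
    and "\<epsilon>\<^sub>0 > 0" and "\<delta>\<^sub>0 > 0"
    and "(MIN i\<in>{1..n}. MIN x\<in>\<Omega> i. escape_tail K (\<Omega> i) (\<epsilon>\<^sub>0 * real (phi_max K n \<Omega>)) x) \<ge> \<delta>\<^sub>0"
    and "\<epsilon> > 0" and "\<delta> > 0"
    and "(MAX i\<in>{1..n}. MAX x\<in>\<Omega> i. escape_tail K (\<Omega> i) (\<epsilon> * real (phi_max K n \<Omega>)) x) \<le> 1 - \<delta>"
    and "c > 0"
    and "digraph_diameter {1..n} (escape_edges K n \<Omega> c) = enat D"
  shows "phi_hit K \<pi> n \<Omega> \<alpha> \<le>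
    ennreal (\<epsilon> * real (phi_max K n \<Omega>) * real D * (c * \<delta>) powi (- int D))"
proof -
  let ?s = "\<epsilon> * real (phi_max K n \<Omega>)"
  define m where "m = nat \<lfloor>?s\<rfloor>"
  define r where "r = ?s / \<delta>"
  let ?E = "escape_edges K n \<Omega> c"
  note disj = assms(5) and cover = assms(6) and nonempty = assms(7)
  have s0: "?s \<ge> 0" using \<open>\<epsilon> > 0\<close> by simp
  have r0: "r \<ge> 0" using s0 \<open>\<delta> > 0\<close> by (simp add: r_def)
  have n: "{1..n} \<noteq> {}" using cover by auto
  have tail: "avoid_prob K (- \<Omega> i) m x \<le> 1 - \<delta>" if "i \<in> {1..n}" "x \<in> \<Omega> i" for i x
  proof -
    have "escape_tail K (\<Omega> i) ?s x \<le> (MAX x\<in>\<Omega> i. escape_tail K (\<Omega> i) ?s x)"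
      using that by (intro Max_ge) auto
    also have "\<dots> \<le> (MAX i\<in>{1..n}. MAX x\<in>\<Omega> i. escape_tail K (\<Omega> i) ?s x)"
      using that by (intro Max_ge) auto
    finally show ?thesis
      using assms(15) unfolding m_def escape_tail_eq_avoid_prob[OF s0, symmetric] by linarith
  qed
  \<comment> \<open>A tail probability is nonnegative. The bound allows \<open>\<delta> ^ D\<close>
    to be replaced by \<open>\<delta>\<close> at the end.\<close>
  have \<delta>1: "\<delta> \<le> 1"
  proof -
    obtain i where i: "i \<in> {1..n}" using n by blast
    then obtain x where "x \<in> \<Omega> i" using nonempty by blast
    with tail[OF i] avoid_prob_nonneg[of K "- \<Omega> i" m x] show ?thesis by fastforce
  qed
  have exit_time: "(\<Sum>k<T. avoid_prob K (- \<Omega> i) k x) \<le> r" if "i \<in> {1..n}" "x \<in> \<Omega> i" for i x T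
  proof -
    have "(\<Sum>k<T. avoid_prob K (- \<Omega> i) k x) \<le> real m / \<delta>"
      using tail[OF that(1)] \<open>\<delta> > 0\<close> that(2) by (rule sum_avoid_prob_le)
    also have "\<dots> \<le> r"
      unfolding r_def m_def using s0 \<open>\<delta> > 0\<close> by (intro divide_right_mono) linarith+
    finally show ?thesis .
  qed
  have edge: "c \<le> measure (path_measure K x) (stopped_in (escape_time (\<Omega> i)) (\<Omega> j))"
    if "(i, j) \<in> ?E" "x \<in> \<Omega> i" for i j x
  proof -
    have "(MIN x\<in>\<Omega> i. measure (path_measure K x) (stopped_in (escape_time (\<Omega> i)) (\<Omega> j)))
        \<le> measure (path_measure K x) (stopped_in (escape_time (\<Omega> i)) (\<Omega> j))"
      using that by (intro Min_le) auto
    then show ?thesis using that(1) unfolding escape_edges_def by auto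
  qed
  \<comment> \<open>The number \<open>c\<close> is tied to a probability through an edge, so this is
    available along walks of positive length.\<close>
  have c1: "c \<le> 1" if "(i, j) \<in> ?E" for i j
  proof -
    have "i \<in> {1..n}" using that by (auto simp: escape_edges_def)
    then obtain x where "x \<in> \<Omega> i" using nonempty by blast
    with edge[OF that] prob_space.prob_le_1[OF prob_space_path_measure, of K x] show ?thesis
      using order_trans by blast
  qed
  let ?B = "?s * real D * (c * \<delta>) powi (- int D)"
  have B0: "?B \<ge> 0" using \<open>\<epsilon> > 0\<close> \<open>c > 0\<close> \<open>\<delta> > 0\<close> by (intro mult_nonneg_nonneg zero_le_power_int) auto
  have hit: "truncated_hit K (\<Union>i\<in>I. \<Omega> i) T z \<le> ?B" if I: "I \<subseteq> {1..n}" "I \<noteq> {}" for I T z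
  proof -
    let ?A = "\<Union>i\<in>I. \<Omega> i"
    let ?u = "truncated_hit K ?A T"
    define L where "L = Max (range ?u)"
    have uL: "?u y \<le> L" for y by (simp add: L_def)
    have L0: "L \<ge> 0" using truncated_hit_nonneg[of K ?A T z] uL[of z] by linarith
    have walk: "?u x \<le> L - c ^ k * L + r * real k"
      if "(i, j) \<in> ?E ^^ k" "j \<in> I" "i \<in> {1..n}" "x \<in> \<Omega> i" for i j k x
      using that
    proof (induction k arbitrary: i x)
      case 0
      then have "?u x = 0" by (intro truncated_hit_in) auto
      then show ?case by simp
    next
      case (Suc k)
      obtain i' where i': "(i, i') \<in> ?E" "(i', j) \<in> ?E ^^ k"
        using Suc.prems(1) by (blast dest: relpow_Suc_D2)
      have i'n: "i' \<in> {1..n}" using i' by (auto simp: escape_edges_def)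
      have c: "c \<le> 1" using c1 i'(1) .
      \<comment> \<open>The inductive bound may exceed \<open>L\<close> because of its term in
        \<open>r\<close>. The minimum secures \<open>L - l \<ge> 0\<close>, needed to replace the
        exit probability by its lower bound \<open>c\<close>.\<close>
      define l where "l = min L (L - c ^ k * L + r * real k)"
      have l: "?u y \<le> l" if "y \<in> \<Omega> i'" for y
        using Suc.IH[OF i'(2) Suc.prems(2) i'n that] uL[of y] by (simp add: l_def)
      have step: "?u x \<le> r + L - (L - l) * c"
      \<comment> \<open>Optional stopping needs \<open>\<Omega> i\<close> disjoint from both the
        target and \<open>\<Omega> i'\<close>. If \<open>i \<in> I\<close>, the function vanishes at
        \<open>x\<close>; if \<open>i' = i\<close>, an escape cannot land in
        \<open>\<Omega> i\<close>, contradicting \<open>c > 0\<close>.\<close>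
      proof (cases "i \<in> I \<or> i' = i")
        case True
        then show ?thesis
        proof
          assume "i \<in> I"
          then have "?u x = 0" using Suc.prems by (intro truncated_hit_in) auto
          moreover have "l \<ge> 0"
          proof -
            obtain y where "y \<in> \<Omega> i'" using nonempty i'n by blast
            then show ?thesis using l truncated_hit_nonneg order_trans by blast
          qed
          then have "(L - l) * c \<le> L * 1" using c \<open>c > 0\<close> L0 by (intro mult_mono) auto
          ultimately show ?thesis using r0 by linarith
        next
          assume "i' = i"
          then have "stopped_in (escape_time (\<Omega> i)) (\<Omega> i') = {}"
            by (auto simp: stopped_in_def escape_time_eq_return_time return_time_eq_enat_iff)
          then show ?thesis using edge[OF i'(1) Suc.prems(4)] \<open>c > 0\<close> by simp
        qed
      next
        case False
        have BS: "\<Omega> i' \<inter> \<Omega> i = {}"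
          using False disj i'n Suc.prems(3) by (auto simp: disjoint_family_on_def)
        have disjA: "y \<notin> ?A" if "y \<in> \<Omega> i" for y
        proof
          assume "y \<in> ?A"
          then obtain i2 where "i2 \<in> I" "y \<in> \<Omega> i2" by blast
          with False I(1) Suc.prems(3) that show False
            using disjoint_family_onD[OF disj, of i2 i] by blast
        qed
        \<comment> \<open>The horizon \<open>T\<close> inside \<open>?u\<close> stays fixed, while
          the separate exit horizon \<open>t\<close> tends to infinity.\<close>
        have "?u x \<le> r + L - (L - l) * exit_prob K (\<Omega> i) (\<Omega> i') t x" for t
        proof -
          have "?u x \<le> (\<Sum>k<t. avoid_prob K (- \<Omega> i) k x) + L - (L - l) * exit_prob K (\<Omega> i) (\<Omega> i') t x"
            by (rule optional_stopping_at_exit[OF BS])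
              (use truncated_hit_superharmonic[OF disjA] l uL Suc.prems in auto)
          then show ?thesis using exit_time[OF Suc.prems(3,4), of t] by linarith
        qed
        moreover have "(\<lambda>t. r + L - (L - l) * exit_prob K (\<Omega> i) (\<Omega> i') t x) \<longlonglongrightarrow>
            r + L - (L - l) * measure (path_measure K x) (stopped_in (escape_time (\<Omega> i)) (\<Omega> i'))"
          by (intro tendsto_intros exit_prob_tendsto BS)
        ultimately have "?u x \<le> r + L - (L - l) * measure (path_measure K x) (stopped_in (escape_time (\<Omega> i)) (\<Omega> i'))"
          by (intro LIMSEQ_le_const) auto
        also have "\<dots> \<le> r + L - (L - l) * c"
          using edge[OF i'(1) Suc.prems(4)] by (intro diff_left_mono mult_left_mono) (auto simp: l_def)
        finally show ?thesis .
      qed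
      also have "\<dots> \<le> r + L - (c ^ k * L - r * real k) * c"
        using \<open>c > 0\<close> by (intro diff_left_mono mult_right_mono) (auto simp: l_def)
      also have "\<dots> = L - c ^ Suc k * L + r + c * (r * real k)"
        by (simp add: algebra_simps)
      \<comment> \<open>Dropping the factor \<open>c \<le> 1\<close> in front of
        \<open>r * real k\<close> makes the additive error linear in the walk length.\<close>
      also have "\<dots> \<le> L - c ^ Suc k * L + r + 1 * (r * real k)"
        using c r0 by (intro add_left_mono mult_right_mono) auto
      finally show ?case by (simp add: algebra_simps)
    qed
    obtain x where x: "?u x = L"
      using Max_in[of "range ?u"] unfolding L_def by fastforce
    obtain i where i: "i \<in> {1..n}" "x \<in> \<Omega> i" using cover by blast
    obtain j where j: "j \<in> I" using I(2) by blast
    with I(1) have jn: "j \<in> {1..n}" by blast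
    obtain k where k: "k \<le> D" "(i, j) \<in> ?E ^^ k"
      by (rule walk_of_digraph_diameter[OF assms(17) i(1) jn])
    have kL: "c ^ k * L \<le> r * real k"
      using walk[OF k(2) j i] x by simp
    \<comment> \<open>A walk of length 0 gives \<open>L \<le> 0\<close>, and \<open>D\<close> may
      then be 0. Any longer walk has an edge, hence \<open>c \<le> 1\<close> and
      \<open>D \<ge> 1\<close>.\<close>
    have "L \<le> ?B"
    proof (cases k)
      case 0
      then show ?thesis using kL B0 by simp
    next
      case (Suc k')
      have D: "1 \<le> D" using Suc k(1) by simp
      have "c \<le> 1" using k(2) c1 unfolding Suc by (blast dest: relpow_Suc_D2)
      then have "c ^ D * L \<le> c ^ k * L"
        using k(1) \<open>c > 0\<close> L0 by (intro mult_right_mono power_decreasing) auto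
      also have "\<dots> \<le> r * real D"
        using kL k(1) r0 by (meson mult_left_mono of_nat_le_iff order_trans)
      finally have "\<delta> ^ D * (c ^ D * L) \<le> \<delta> ^ D * (r * real D)"
        using \<open>\<delta> > 0\<close> by (intro mult_left_mono) auto
      \<comment> \<open>Here \<open>D \<ge> 1\<close> gives
        \<open>\<delta> ^ D \<le> \<delta>\<close>, which cancels the denominator of
        \<open>r\<close>; this weakens the factor \<open>1 / \<delta>\<close> to the stated
        power.\<close>
      also have "\<dots> \<le> \<delta> * (r * real D)"
        using \<open>\<delta> > 0\<close> \<delta>1 D r0 power_decreasing[of 1 D \<delta>] by (intro mult_right_mono) auto
      also have "\<dots> = ?s * real D" using \<open>\<delta> > 0\<close> by (simp add: r_def)
      finally have "(c * \<delta>) ^ D * L \<le> ?s * real D" by (simp add: power_mult_distrib mult_ac)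
      then show ?thesis
        using \<open>c > 0\<close> \<open>\<delta> > 0\<close> by (simp add: power_int_minus field_simps)
    qed
    then show ?thesis using uL order_trans by blast
  qed
  let ?\<I> = "{I. I \<subseteq> {1..n} \<and> measure_pmf.prob \<pi> (\<Union>i\<in>I. \<Omega> i) \<ge> \<alpha> / 2}"
  \<comment> \<open>The whole space has mass 1, so the outer maximum is over a nonempty
    family.\<close>
  have "{1..n} \<in> ?\<I>" using cover \<open>\<alpha> < 1 / 2\<close> by simp
  then have "?\<I> \<noteq> {}" by blast
  moreover have "finite ?\<I>" by simp
  moreover have "(MAX x\<in>UNIV. expected_hitting_time K x (\<Union>i\<in>I. \<Omega> i)) \<le> ennreal ?B" if "I \<in> ?\<I>" for I
  proof -
    \<comment> \<open>The empty union has mass 0, below \<open>\<alpha> / 2\<close>.\<close>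
    have "I \<noteq> {}" using that \<open>0 < \<alpha>\<close> by auto
    then have "expected_hitting_time K x (\<Union>i\<in>I. \<Omega> i) \<le> ennreal ?B" for x
      using that hit by (intro expected_hitting_time_le) blast
    then show ?thesis by simp
  qed
  ultimately show ?thesis unfolding phi_hit_def by simp
qed

end
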